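(* Let $d \geq 2$, let $H$ be a subgroup of $\mathrm{Sym}(d)$ and let $X = \{1,\dots,d\}$. Then the fixed-point proportion of $W_H$ is $$\mathrm{FPP}(W_H) = \begin{cases} 0 & \text{if } H \text{ is transitive over } X, \\ \alpha \in (0,1) & \text{if } H \text{ is not transitive over } X \text{ and there exists } \sigma \in H \text{ with no fixed points in } X, \\ 1 & \text{if } H \text{ is not transitive over } X \text{ and every element of } H \text{ fixes a point of } X, \end{cases}$$ where $\alpha$ is an algebraic integer.
   Context: $T$ is the $d$-regular rooted tree, identified with the set of finite words over $\{1,\dots,d\}$; $\mathcal{L}_n$ is its $n$-th level and $\mathrm{Aut}(T)$ is the group of bijections of $T$ fixing the root and preserving adjacency. $\pi_n$ denotes the restriction of the action of an element of $\mathrm{Aut}(T)$ to the first $n$ levels of $T$. For $g \in \mathrm{Aut}(T)$ and $v \in T$, the section $g|_v \in \mathrm{Aut}(T)$ is defined by $g(vw)=g(v)\,g|_v(w)$ for all words $w$, and the label $g|_v^1 \in \mathrm{Sym}(d)$ is the permutation of $\{1,\dots,d\}$ induced by $g|_v$ on the first level. For a subgroup $H \le \mathrm{Sym}(d)$, the iterated wreath product is the subgroup $W_H := \{g \in \mathrm{Aut}(T) : g|_v^1 \in H \text{ for all } v \in T\}$. For a subgroup $G \le \mathrm{Aut}(T)$, $$\mathrm{FPP}(G) := \lim_{n\to\infty} \frac{\#\{g \in \pi_n(G) : g \text{ fixes a vertex in } \mathcal{L}_n\}}{|\pi_n(G)|}.$$ *)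

theory Defs
  imports Complex_Main "HOL-Algebra.Sym_Groups" "HOL-Computational_Algebra.Polynomial"
begin

definition tree :: "nat \<Rightarrow> nat list set" where
  "tree d = lists {1..d}"

definition level :: "nat \<Rightarrow> nat \<Rightarrow> nat list set" where
  "level d n = {v \<in> tree d. length v = n}"

definition adjacent :: "nat list \<Rightarrow> nat list \<Rightarrow> bool" where
  "adjacent u v \<longleftrightarrow> (\<exists>x. v = u @ [x]) \<or> (\<exists>x. u = v @ [x])"

(* As in sym_group, permutations are total functions that are the identity off their domain,
   so that equality of functions is equality of automorphisms. *)
definition tree_aut :: "nat \<Rightarrow> (nat list \<Rightarrow> nat list) set" where
  "tree_aut d = {g. g permutes tree d \<and> g [] = [] \<and>
     (\<forall>u\<in>tree d. \<forall>v\<in>tree d. adjacent (g u) (g v) \<longleftrightarrow> adjacent u v)}"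

(* Removing the prefix g v from g (v @ w) is the defining equation
   g (v @ w) = g v @ aut_section d g v w; see aut_section_append and aut_section_unique. *)
definition aut_section ::
    "nat \<Rightarrow> (nat list \<Rightarrow> nat list) \<Rightarrow> nat list \<Rightarrow> nat list \<Rightarrow> nat list" where
  "aut_section d g v = (\<lambda>w. if w \<in> tree d then drop (length (g v)) (g (v @ w)) else w)"

definition label :: "nat \<Rightarrow> (nat list \<Rightarrow> nat list) \<Rightarrow> nat list \<Rightarrow> nat \<Rightarrow> nat" where
  "label d g v = (\<lambda>x. if x \<in> {1..d} then hd (aut_section d g v [x]) else x)"

definition iterated_wreath :: "nat \<Rightarrow> (nat \<Rightarrow> nat) set \<Rightarrow> (nat list \<Rightarrow> nat list) set" where
  "iterated_wreath d H = {g \<in> tree_aut d. \<forall>v\<in>tree d. label d g v \<in> H}"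

definition level_restrict ::
    "nat \<Rightarrow> nat \<Rightarrow> (nat list \<Rightarrow> nat list) \<Rightarrow> (nat list \<Rightarrow> nat list)" where
  "level_restrict d n g = restrict g {v \<in> tree d. length v \<le> n}"

definition fix_ratio :: "nat \<Rightarrow> (nat list \<Rightarrow> nat list) set \<Rightarrow> nat \<Rightarrow> real" where
  "fix_ratio d G n =
     real (card {g \<in> level_restrict d n ` G. \<exists>v\<in>level d n. g v = v}) /
     real (card (level_restrict d n ` G))"

definition FPP :: "nat \<Rightarrow> (nat list \<Rightarrow> nat list) set \<Rightarrow> real" where
  "FPP d G = lim (fix_ratio d G)"

definition transitive_over :: "('a \<Rightarrow> 'a) set \<Rightarrow> 'a set \<Rightarrow> bool" where
  "transitive_over H X \<longleftrightarrow> (\<forall>x\<in>X. \<forall>y\<in>X. \<exists>\<sigma>\<in>H. \<sigma> x = y)"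

lemma tree_append [simp]: "u @ v \<in> tree d \<longleftrightarrow> u \<in> tree d \<and> v \<in> tree d"
  by (auto simp: tree_def)

lemma tree_aut_in_tree: "g \<in> tree_aut d \<Longrightarrow> v \<in> tree d \<Longrightarrow> g v \<in> tree d"
  by (auto simp: tree_aut_def permutes_in_image)

lemma tree_aut_inj: "g \<in> tree_aut d \<Longrightarrow> g u = g v \<Longrightarrow> u = v"
  by (auto simp: tree_aut_def dest!: permutes_inj dest: injD)

lemma tree_aut_child:
  assumes g: "g \<in> tree_aut d" and "v @ [x] \<in> tree d"
  shows "\<exists>y. g (v @ [x]) = g v @ [y]"
  using assms(2)
proof (induction v arbitrary: x rule: rev_induct)
  case Nil
  have "[] \<in> tree d" by (simp add: tree_def)
  moreover have "adjacent [] [x]" by (simp add: adjacent_def)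
  ultimately have "adjacent [] (g [x])"
    using g Nil by (force simp: tree_aut_def)
  then show ?case using g by (auto simp: adjacent_def tree_aut_def)
next
  case (snoc z v)
  have "v @ [z] \<in> tree d" using snoc.prems tree_append by blast
  then obtain y where y: "g (v @ [z]) = g v @ [y]" using snoc.IH by blast
  have "adjacent (v @ [z]) ((v @ [z]) @ [x])" by (auto simp: adjacent_def)
  then have "adjacent (g (v @ [z])) (g ((v @ [z]) @ [x]))"
    using g snoc.prems \<open>v @ [z] \<in> tree d\<close> unfolding tree_aut_def by blast
  moreover have "g ((v @ [z]) @ [x]) \<noteq> g v"
    using tree_aut_inj[OF g] by fastforce
  ultimately show ?case using y by (auto simp: adjacent_def)
qed

lemma tree_aut_append:
  assumes g: "g \<in> tree_aut d" and "v @ w \<in> tree d"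
  shows "\<exists>w'. length w' = length w \<and> g (v @ w) = g v @ w'"
  using assms(2)
proof (induction w rule: rev_induct)
  case (snoc x w)
  then obtain w' where "length w' = length w" "g (v @ w) = g v @ w'" by force
  moreover obtain y where "g ((v @ w) @ [x]) = g (v @ w) @ [y]"
    using tree_aut_child[OF g, of "v @ w" x] snoc.prems by auto
  ultimately show ?case by (intro exI[of _ "w' @ [y]"]) simp
qed auto

lemma tree_aut_length: "g \<in> tree_aut d \<Longrightarrow> length (g v) = length v"
  using tree_aut_append[of g d "[]" v]
  by (cases "v \<in> tree d") (auto simp: tree_aut_def permutes_not_in)

lemma aut_section_append:
  assumes "g \<in> tree_aut d" "v \<in> tree d" "w \<in> tree d"
  shows "g (v @ w) = g v @ aut_section d g v w"
  using tree_aut_append[OF assms(1), of v w] assms by (auto simp: aut_section_def)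

lemma aut_section_tree_aut:
  assumes g: "g \<in> tree_aut d" and v: "v \<in> tree d"
  shows "aut_section d g v \<in> tree_aut d"
proof -
  let ?s = "aut_section d g v"
  note app = aut_section_append[OF g v]
  have s_in: "?s w \<in> tree d" if "w \<in> tree d" for w
    using tree_aut_in_tree[OF g, of "v @ w"] app[OF that] v that by simp
  have inj: "inj_on ?s (tree d)"
    by (intro inj_onI) (metis app g tree_aut_inj same_append_eq)
  have surj: "\<exists>w\<in>tree d. ?s w = w'" if w': "w' \<in> tree d" for w'
  proof -
    have perm: "g permutes tree d" using g by (simp add: tree_aut_def)
    define u where "u = inv' g (g v @ w')"
    have gu: "g u = g v @ w'" by (simp add: u_def permutes_inverses[OF perm])
    have u: "u \<in> tree d"
      using permutes_in_image[OF perm, of u] gu w' tree_aut_in_tree[OF g v] by simp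
    let ?a = "take (length v) u" and ?b = "drop (length v) u"
    obtain b' where b': "g (?a @ ?b) = g ?a @ b'" "length b' = length ?b"
      using tree_aut_append[OF g, of ?a ?b] u by auto
    have "length u = length v + length w'"
      using arg_cong[OF gu, of length] by (simp add: tree_aut_length[OF g])
    then have "length (g ?a) = length (g v)" by (simp add: tree_aut_length[OF g])
    moreover have "g ?a @ b' = g v @ w'" using b' gu by simp
    ultimately have "g ?a = g v" by simp
    then have "?a = v" by (rule tree_aut_inj[OF g])
    then have "u = v @ ?b" by (metis append_take_drop_id)
    moreover from this u have "?b \<in> tree d" by (metis tree_append)
    ultimately show ?thesis using app[of ?b] gu by (metis same_append_eq)
  qed
  have "bij_betw ?s (tree d) (tree d)"
    using inj s_in surj by (auto simp: bij_betw_def)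
  then have "?s permutes tree d"
    by (rule bij_imp_permutes) (simp add: aut_section_def)
  moreover have "?s [] = []"
    by (simp add: aut_section_def)
  moreover have "adjacent (?s a) (?s b) \<longleftrightarrow> adjacent a b" if "a \<in> tree d" "b \<in> tree d" for a b
  proof -
    have "adjacent (g (v @ a)) (g (v @ b)) \<longleftrightarrow> adjacent (v @ a) (v @ b)"
      using g v that by (simp add: tree_aut_def)
    then show ?thesis using app that by (simp add: adjacent_def)
  qed
  ultimately show ?thesis by (simp add: tree_aut_def)
qed

lemma aut_section_unique:
  assumes "g \<in> tree_aut d" "v \<in> tree d" "h \<in> tree_aut d"
    and "\<And>w. w \<in> tree d \<Longrightarrow> g (v @ w) = g v @ h w"
  shows "h = aut_section d g v"
proof
  fix w
  show "h w = aut_section d g v w"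
    using assms by (cases "w \<in> tree d") (auto simp: aut_section_def tree_aut_def permutes_not_in)
qed

end

theory Submission
  imports Defs
begin

text \<open>Cutting an element of \<open>W\<^sub>H\<close> at the root writes it as a root label
  \<open>\<sigma> \<in> H\<close> together with \<open>d\<close> independent elements of \<open>W\<^sub>H\<close>, so the proportion
  \<open>q\<^sub>n\<close> of elements of \<open>\<pi>\<^sub>n(W\<^sub>H)\<close> fixing no vertex of level \<open>n\<close> is the probability that a
  Galton--Watson process is extinct by generation \<open>n\<close>: \<open>q\<^sub>0 = 0\<close> and \<open>q\<^bsub>n+1\<^esub> = F(q\<^sub>n)\<close>, where
  \<open>F(q)\<close> is the mean over \<open>\<sigma> \<in> H\<close> of \<open>q\<close> to the power of the number of fixed points of \<open>\<sigma>\<close>. The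
  limit is a fixed point of \<open>F\<close>, hence an algebraic integer, because only the identity has \<open>d\<close>
  fixed points and so \<open>|H| (F(q) - q)\<close> is monic. The mean number of fixed points is the number of
  orbits, so the process is critical and dies out if \<open>H\<close> is transitive, and is supercritical
  otherwise.\<close>

section \<open>Cutting and gluing automorphisms at the root\<close>

lemma adjacent_simps [simp]:
  "adjacent (x # u) (y # v) \<longleftrightarrow> x = y \<and> adjacent u v"
  "\<not> adjacent [] []"
  "adjacent [] (x # u) \<longleftrightarrow> u = []"
  "adjacent (x # u) [] \<longleftrightarrow> u = []"
  by (auto simp: adjacent_def)

lemma tree_Nil [simp]: "[] \<in> tree d"
  and tree_Cons [simp]: "x # w \<in> tree d \<longleftrightarrow> x \<in> {1..d} \<and> w \<in> tree d"
  by (auto simp: tree_def)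

lemma aut_section_append_section:
  assumes "g \<in> tree_aut d" "u \<in> tree d" "v \<in> tree d"
  shows "aut_section d (aut_section d g u) v = aut_section d g (u @ v)"
proof
  fix w
  show "aut_section d (aut_section d g u) v w = aut_section d g (u @ v) w"
    using aut_section_append[OF assms(1,2)] assms tree_aut_length[OF assms(1)]
      tree_aut_length[OF aut_section_tree_aut[OF assms(1,2)]]
    by (cases "w \<in> tree d") (simp_all add: aut_section_def add.commute)
qed

lemma label_append:
  assumes "g \<in> tree_aut d" "u \<in> tree d" "v \<in> tree d"
  shows "label d (aut_section d g u) v = label d g (u @ v)"
  unfolding label_def aut_section_append_section[OF assms] ..

lemma iterated_wreath_section:
  assumes "g \<in> iterated_wreath d H" "u \<in> tree d"
  shows "aut_section d g u \<in> iterated_wreath d H"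
  using assms by (auto simp: iterated_wreath_def aut_section_tree_aut label_append)

text \<open>Recovers an automorphism from its root label and its sections at the first level; this
  is what makes gluing at the root surjective.\<close>

lemma tree_aut_Cons:
  assumes "g \<in> tree_aut d" "x \<in> {1..d}" "w \<in> tree d"
  shows "g (x # w) = label d g [] x # aut_section d g [x] w"
proof -
  have "g [] = []" using assms(1) by (simp add: tree_aut_def)
  then have "label d g [] x = hd (g [x])"
    using assms(2) by (simp add: label_def aut_section_def)
  moreover have "length (g [x]) = 1" using tree_aut_length[OF assms(1)] by simp
  then have "g [x] = [hd (g [x])]" by (cases "g [x]") auto
  ultimately show ?thesis
    using aut_section_append[OF assms(1), of "[x]" w] assms(2,3) by simp
qed

text \<open>Inverse of cutting at the root. Words outside the tree stay put, since
  \<open>permutes\<close> demands the identity there.\<close>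

definition root_glue ::
    "nat \<Rightarrow> (nat \<Rightarrow> nat) \<Rightarrow> (nat \<Rightarrow> nat list \<Rightarrow> nat list) \<Rightarrow> nat list \<Rightarrow> nat list" where
  "root_glue d s h v =
     (case v of [] \<Rightarrow> [] | x # w \<Rightarrow> if v \<in> tree d then s x # h x w else v)"

lemma root_glue_tree_aut:
  assumes s: "s permutes {1..d}" and h: "\<And>x. x \<in> {1..d} \<Longrightarrow> h x \<in> tree_aut d"
  shows "root_glue d s h \<in> tree_aut d"
proof -
  let ?g = "root_glue d s h"
  have sx: "s x \<in> {1..d} \<longleftrightarrow> x \<in> {1..d}" for x using permutes_in_image[OF s] .
  have s_inj: "s x = s y \<longleftrightarrow> x = y" for x y using permutes_inj[OF s] by (auto dest: injD)
  have h_inj: "h x u = h x v \<longleftrightarrow> u = v" if "x \<in> {1..d}" for x u v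
    using tree_aut_inj[OF h[OF that]] by auto
  have in_tree: "?g v \<in> tree d" if "v \<in> tree d" for v
    using that sx tree_aut_in_tree[OF h] by (auto simp: root_glue_def split: list.splits)
  have inj: "inj_on ?g (tree d)"
    using s_inj h_inj by (auto simp: inj_on_def root_glue_def split: list.splits)
  have surj: "\<exists>u\<in>tree d. ?g u = v" if "v \<in> tree d" for v
  proof (cases v)
    case Nil
    then show ?thesis by (intro bexI[of _ "[]"]) (simp_all add: root_glue_def)
  next
    case (Cons y w)
    have y: "y \<in> {1..d}" and w: "w \<in> tree d" using that Cons by auto
    obtain x where x: "s x = y" "x \<in> {1..d}" using y permutes_surj[OF s] sx by (metis surjD)
    have "h x permutes tree d" using h[OF x(2)] by (simp add: tree_aut_def)
    then obtain w' where w': "h x w' = w" "w' \<in> tree d"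
      using w by (metis permutes_surj permutes_in_image surjD)
    show ?thesis
      using x w' Cons by (intro bexI[of _ "x # w'"]) (simp_all add: root_glue_def)
  qed
  have "bij_betw ?g (tree d) (tree d)"
    using inj in_tree surj by (auto simp: bij_betw_def)
  then have "?g permutes tree d"
    by (rule bij_imp_permutes) (auto simp: root_glue_def split: list.splits)
  moreover have "adjacent (?g u) (?g v) \<longleftrightarrow> adjacent u v" if "u \<in> tree d" "v \<in> tree d" for u v
  proof -
    \<comment> \<open>The root is adjacent to \<open>x # w\<close> only for empty \<open>w\<close>,
      so comparing a word with the root requires each \<open>h x\<close> to preserve
      emptiness.\<close>
    have nil: "h x w = [] \<longleftrightarrow> w = []" if "x \<in> {1..d}" for x w
      using tree_aut_length[OF h[OF that], of w] by (metis length_0_conv)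
    show ?thesis
      using that h nil s_inj
      by (cases u; cases v) (auto simp: root_glue_def tree_aut_def)
  qed
  ultimately show ?thesis by (simp add: tree_aut_def root_glue_def)
qed

text \<open>Gluing creates no new labels: the root carries \<open>s\<close>, and
  \<open>x # w\<close> carries the label of \<open>h x\<close> at \<open>w\<close>.\<close>

lemma root_glue_wreath:
  assumes s: "s permutes {1..d}" "s \<in> H"
    and h: "\<And>x. x \<in> {1..d} \<Longrightarrow> h x \<in> iterated_wreath d H"
  shows "root_glue d s h \<in> iterated_wreath d H"
proof -
  let ?g = "root_glue d s h"
  have aut: "h x \<in> tree_aut d" if "x \<in> {1..d}" for x
    using h[OF that] by (simp add: iterated_wreath_def)
  have "label d ?g v \<in> H" if v: "v \<in> tree d" for v
  proof (cases v)
    case Nil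
    have "label d ?g [] = s"
      using permutes_not_in[OF s(1)] by (auto simp: label_def aut_section_def root_glue_def)
    then show ?thesis using s Nil by simp
  next
    case (Cons x w)
    have "aut_section d ?g (x # w) = aut_section d (h x) w"
      using v Cons by (auto simp: aut_section_def root_glue_def)
    then have "label d ?g v = label d (h x) w" by (auto simp: label_def Cons)
    then show ?thesis using h[of x] v Cons by (simp add: iterated_wreath_def)
  qed
  then show ?thesis using root_glue_tree_aut[OF s(1) aut] by (simp add: iterated_wreath_def)
qed

section \<open>Recursive decomposition of the finite level quotients\<close>

definition wreath_level :: "nat \<Rightarrow> (nat \<Rightarrow> nat) set \<Rightarrow> nat \<Rightarrow> (nat list \<Rightarrow> nat list) set" where
  "wreath_level d H n = level_restrict d n ` iterated_wreath d H"

text \<open>Counted in place of the elements with a fixed vertex: moving every vertex is a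
  conjunction of separate conditions on the sections, so the counts multiply.\<close>

definition derangements :: "nat \<Rightarrow> (nat \<Rightarrow> nat) set \<Rightarrow> nat \<Rightarrow> (nat list \<Rightarrow> nat list) set" where
  "derangements d H n = {g \<in> wreath_level d H n. \<forall>v\<in>level d n. g v \<noteq> v}"

text \<open>The values of \<open>h\<close> are meant to be restrictions to the first
  \<open>n\<close> levels; restricting the result to \<open>Suc n\<close> levels keeps their
  unspecified values from entering.\<close>

definition level_glue ::
    "nat \<Rightarrow> nat \<Rightarrow> (nat \<Rightarrow> nat) \<times> (nat \<Rightarrow> nat list \<Rightarrow> nat list) \<Rightarrow> nat list \<Rightarrow> nat list" where
  "level_glue d n = (\<lambda>(s, h). level_restrict d (Suc n) (root_glue d s h))"

lemma level_glue_Cons: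
  assumes "x \<in> {1..d}" "w \<in> tree d" "length w \<le> n"
  shows "level_glue d n (s, h) (x # w) = s x # h x w"
  using assms by (simp add: level_glue_def level_restrict_def root_glue_def)

lemma wreath_level_Nil: "g \<in> wreath_level d H n \<Longrightarrow> g [] = []"
  by (auto simp: wreath_level_def level_restrict_def iterated_wreath_def tree_aut_def)

lemma wreath_level_extensional:
  "g \<in> wreath_level d H n \<Longrightarrow> g \<in> extensional {v \<in> tree d. length v \<le> n}"
  by (auto simp: wreath_level_def level_restrict_def)

text \<open>The images of the words \<open>x # w\<close> determine \<open>s x\<close> and
  \<open>h x w\<close>. Elsewhere \<open>s\<close> is the identity and \<open>h\<close> is
  extensional, so nothing else can differ.\<close>

lemma level_glue_inj:
  assumes H: "\<And>s. s \<in> H \<Longrightarrow> s permutes {1..d}"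
  shows "inj_on (level_glue d n) (H \<times> (\<Pi>\<^sub>E x\<in>{1..d}. wreath_level d H n))"
proof (rule inj_onI, clarify)
  fix s h s' h'
  assume s: "s \<in> H" "s' \<in> H"
    and h: "h \<in> (\<Pi>\<^sub>E x\<in>{1..d}. wreath_level d H n)" "h' \<in> (\<Pi>\<^sub>E x\<in>{1..d}. wreath_level d H n)"
    and eq: "level_glue d n (s, h) = level_glue d n (s', h')"
  have *: "s x = s' x \<and> h x w = h' x w" if "x \<in> {1..d}" "w \<in> tree d" "length w \<le> n" for x w
    using level_glue_Cons[OF that, of s h] level_glue_Cons[OF that, of s' h'] eq by simp
  have "s x = s' x" for x
    using *[of x "[]"] H[OF s(1)] H[OF s(2)]
    by (cases "x \<in> {1..d}") (auto simp: permutes_not_in)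
  moreover have "h x = h' x" if x: "x \<in> {1..d}" for x
  proof (rule extensionalityI)
    show "h x \<in> extensional {v \<in> tree d. length v \<le> n}"
      "h' x \<in> extensional {v \<in> tree d. length v \<le> n}"
      using wreath_level_extensional PiE_mem[OF h(1) x] PiE_mem[OF h(2) x] by blast+
  qed (use *[OF x] in auto)
  then have "h = h'" using h by (intro PiE_ext) auto
  ultimately show "s = s' \<and> h = h'" by auto
qed

lemma level_glue_image:
  assumes H: "\<And>s. s \<in> H \<Longrightarrow> s permutes {1..d}"
  shows "level_glue d n ` (H \<times> (\<Pi>\<^sub>E x\<in>{1..d}. wreath_level d H n)) = wreath_level d H (Suc n)"
proof (intro equalityI subsetI)
  fix g assume "g \<in> level_glue d n ` (H \<times> (\<Pi>\<^sub>E x\<in>{1..d}. wreath_level d H n))"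
  then obtain s h where g: "g = level_glue d n (s, h)" and s: "s \<in> H"
    and "h \<in> (\<Pi>\<^sub>E x\<in>{1..d}. wreath_level d H n)"
    by auto
  \<comment> \<open>The \<open>h x\<close> are only restrictions, whereas gluing inside
    \<open>iterated_wreath d H\<close> needs automorphisms of the whole tree: lift each one, then
    restrict the glued lift.\<close>
  then have "\<forall>x\<in>{1..d}. \<exists>k\<in>iterated_wreath d H. h x = level_restrict d n k"
    by (fastforce simp: wreath_level_def PiE_def Pi_def)
  then obtain k where k: "\<And>x. x \<in> {1..d} \<Longrightarrow> k x \<in> iterated_wreath d H"
      "\<And>x. x \<in> {1..d} \<Longrightarrow> h x = level_restrict d n (k x)"
    by metis
  have "g = level_restrict d (Suc n) (root_glue d s k)"
    unfolding g level_glue_def prod.case level_restrict_def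
    using k(2)
    by (intro restrict_ext) (auto simp: root_glue_def level_restrict_def split: list.splits)
  moreover have "root_glue d s k \<in> iterated_wreath d H"
    using root_glue_wreath[OF H[OF s] s] k(1) by blast
  ultimately show "g \<in> wreath_level d H (Suc n)" by (auto simp: wreath_level_def)
next
  fix g assume "g \<in> wreath_level d H (Suc n)"
  then obtain k where k: "k \<in> iterated_wreath d H" and g: "g = level_restrict d (Suc n) k"
    by (auto simp: wreath_level_def)
  have aut: "k \<in> tree_aut d" using k by (simp add: iterated_wreath_def)
  let ?s = "label d k []"
  let ?h = "\<lambda>x\<in>{1..d}. level_restrict d n (aut_section d k [x])"
  have "g = level_glue d n (?s, ?h)"
    unfolding g level_glue_def prod.case level_restrict_def
    using tree_aut_Cons[OF aut] aut
    by (intro restrict_ext)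
      (auto simp: root_glue_def level_restrict_def tree_aut_def split: list.splits)
  moreover have "?s \<in> H" using k by (simp add: iterated_wreath_def)
  moreover have "?h \<in> (\<Pi>\<^sub>E x\<in>{1..d}. wreath_level d H n)"
    using iterated_wreath_section[OF k] by (auto simp: wreath_level_def)
  ultimately show "g \<in> level_glue d n ` (H \<times> (\<Pi>\<^sub>E x\<in>{1..d}. wreath_level d H n))" by blast
qed

text \<open>The image of \<open>x # w\<close> is \<open>s x # h x w\<close>, so a letter moved by
  \<open>s\<close> imposes no condition on the section below it.\<close>

lemma level_glue_derangement_iff:
  "(\<forall>v\<in>level d (Suc n). level_glue d n (s, h) v \<noteq> v) \<longleftrightarrow>
   (\<forall>x\<in>{1..d}. s x = x \<longrightarrow> (\<forall>w\<in>level d n. h x w \<noteq> w))" (is "?L \<longleftrightarrow> ?R")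
proof
  assume L: ?L
  show ?R
  proof (intro ballI impI)
    fix x w assume "x \<in> {1..d}" "s x = x" "w \<in> level d n"
    then show "h x w \<noteq> w"
      using L[rule_format, of "x # w"] by (auto simp: level_def level_glue_Cons)
  qed
next
  assume R: ?R
  show ?L
  proof
    fix v assume v: "v \<in> level d (Suc n)"
    then obtain x w where "v = x # w" "x \<in> {1..d}" "w \<in> tree d" "length w = n"
      by (cases v) (auto simp: level_def)
    then show "level_glue d n (s, h) v \<noteq> v"
      using R by (auto simp: level_glue_Cons level_def)
  qed
qed

lemma derangements_Suc:
  assumes H: "\<And>s. s \<in> H \<Longrightarrow> s permutes {1..d}"
  shows "derangements d H (Suc n) = level_glue d n `
    (SIGMA s:H. \<Pi>\<^sub>E x\<in>{1..d}. if s x = x then derangements d H n else wreath_level d H n)"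
    (is "_ = _ ` ?S")
proof -
  have S: "?S = {p \<in> H \<times> (\<Pi>\<^sub>E x\<in>{1..d}. wreath_level d H n).
      \<forall>v\<in>level d (Suc n). level_glue d n p v \<noteq> v}"
  proof (rule Set.set_eqI)
    fix p :: "(nat \<Rightarrow> nat) \<times> (nat \<Rightarrow> nat list \<Rightarrow> nat list)"
    obtain s h where p: "p = (s, h)" by (cases p)
    show "p \<in> ?S \<longleftrightarrow> p \<in> {p \<in> H \<times> (\<Pi>\<^sub>E x\<in>{1..d}. wreath_level d H n).
        \<forall>v\<in>level d (Suc n). level_glue d n p v \<noteq> v}"
      unfolding p mem_Collect_eq mem_Sigma_iff level_glue_derangement_iff
      by (auto simp: derangements_def PiE_iff split: if_splits)
  qed
  have image: "wreath_level d H (Suc n) =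
      level_glue d n ` (H \<times> (\<Pi>\<^sub>E x\<in>{1..d}. wreath_level d H n))"
    using level_glue_image[of H d n] H by simp
  show ?thesis unfolding S derangements_def[of d H "Suc n"] image by blast
qed

section \<open>Orbit counting: the mean number of fixed points in \<open>H\<close>\<close>

abbreviation nfix :: "nat \<Rightarrow> (nat \<Rightarrow> nat) \<Rightarrow> nat" where
  "nfix d s \<equiv> card {x \<in> {1..d}. s x = x}"

locale perm_group =
  fixes d :: nat and H :: "(nat \<Rightarrow> nat) set"
  assumes d2: "d \<ge> 2" and subgroup: "subgroup H (sym_group d)"
begin

lemma permutes: "s \<in> H \<Longrightarrow> s permutes {1..d}"
  using subgroup.subset[OF subgroup] by (auto simp: sym_group_carrier)

lemma id_in: "id \<in> H"
  using subgroup.one_closed[OF subgroup] by (simp add: sym_group_one)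

lemma comp_in: "s \<in> H \<Longrightarrow> t \<in> H \<Longrightarrow> s \<circ> t \<in> H"
  using subgroup.m_closed[OF subgroup] by (simp add: sym_group_mult)

lemma inv_in: "s \<in> H \<Longrightarrow> inv' s \<in> H"
  using subgroup.m_inv_closed[OF subgroup, of s] subgroup.subset[OF subgroup] by auto

lemma finite_H: "finite H"
  using permutes by (auto intro: finite_subset[OF _ finite_permutations[of "{1..d}"]])

lemma card_pos: "card H > 0"
  using finite_H id_in by (auto simp: card_gt_0_iff)

text \<open>Right composition with \<open>inv' s\<close> carries the coset onto a stabilizer. Taking
  the stabilizer of \<open>y\<close>, not of \<open>x\<close>, makes the sum over an orbit a partial
  sum of the one in \<open>sum_nfix\<close>.\<close>

lemma card_transporter:
  assumes "s \<in> H" "s x = y"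
  shows "card {t \<in> H. t x = y} = card {t \<in> H. t y = y}"
proof (rule bij_betw_same_card)
  show "bij_betw (\<lambda>t. t \<circ> inv' s) {t \<in> H. t x = y} {t \<in> H. t y = y}"
  proof (rule bij_betwI[where g = "\<lambda>t. t \<circ> s"])
    have inv: "inv' s y = x" using assms permutes_inverses[OF permutes] by blast
    show "(\<lambda>t. t \<circ> inv' s) \<in> {t \<in> H. t x = y} \<rightarrow> {t \<in> H. t y = y}"
      using assms inv by (simp add: comp_in inv_in)
    show "(\<lambda>t. t \<circ> s) \<in> {t \<in> H. t y = y} \<rightarrow> {t \<in> H. t x = y}"
      using assms by (simp add: comp_in)
    show "t \<circ> inv' s \<circ> s = t" "t \<circ> s \<circ> inv' s = t" for t :: "nat \<Rightarrow> nat"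
      using permutes_inv_o[OF permutes[OF assms(1)]] by (simp_all add: comp_assoc)
  qed
qed

definition orbit where "orbit x = {y \<in> {1..d}. \<exists>s\<in>H. s x = y}"

text \<open>Sort the elements of \<open>H\<close> by the image of \<open>x\<close>. Each orbit thus
  contributes exactly \<open>card H\<close> to the total number of fixed points.\<close>

lemma sum_stabilizers_orbit:
  assumes "x \<in> {1..d}"
  shows "(\<Sum>y\<in>orbit x. card {t \<in> H. t y = y}) = card H"
proof -
  have "H = (\<Union>y\<in>orbit x. {t \<in> H. t x = y})"
    using assms permutes_in_image[OF permutes] unfolding orbit_def by blast
  then have "card H = card (\<Union>y\<in>orbit x. {t \<in> H. t x = y})" by simp
  also have "\<dots> = (\<Sum>y\<in>orbit x. card {t \<in> H. t x = y})"
    using finite_H by (intro card_UN_disjoint) (auto simp: orbit_def)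
  also have "\<dots> = (\<Sum>y\<in>orbit x. card {t \<in> H. t y = y})"
    using card_transporter by (intro sum.cong) (auto simp: orbit_def)
  finally show ?thesis by simp
qed

lemma sum_nfix: "(\<Sum>s\<in>H. nfix d s) = (\<Sum>y\<in>{1..d}. card {t \<in> H. t y = y})"
proof -
  have "(\<Sum>s\<in>H. nfix d s) = (\<Sum>s\<in>H. \<Sum>y\<in>{1..d}. if s y = y then 1 else 0)"
    by (simp add: sum.inter_filter[symmetric])
  also have "\<dots> = (\<Sum>y\<in>{1..d}. \<Sum>s\<in>H. if s y = y then 1 else 0)" by (rule sum.swap)
  also have "\<dots> = (\<Sum>y\<in>{1..d}. card {t \<in> H. t y = y})"
    using finite_H by (simp add: sum.inter_filter[symmetric])
  finally show ?thesis .
qed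

lemma sum_nfix_transitive:
  assumes "transitive_over H {1..d}"
  shows "(\<Sum>s\<in>H. nfix d s) = card H"
proof -
  have "orbit 1 = {1..d}" using assms d2 by (auto simp: orbit_def transitive_over_def)
  then show ?thesis using sum_stabilizers_orbit[of 1] d2 sum_nfix by simp
qed

text \<open>Two points that \<open>H\<close> does not connect have disjoint orbits, each
  contributing \<open>card H\<close>.\<close>

lemma sum_nfix_intransitive:
  assumes "\<not> transitive_over H {1..d}"
  shows "(\<Sum>s\<in>H. nfix d s) \<ge> 2 * card H"
proof -
  obtain x y where xy: "x \<in> {1..d}" "y \<in> {1..d}" "\<And>s. s \<in> H \<Longrightarrow> s x \<noteq> y"
    using assms by (auto simp: transitive_over_def)
  have disj: "orbit x \<inter> orbit y = {}"
  proof (rule ccontr)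
    assume "orbit x \<inter> orbit y \<noteq> {}"
    then obtain z where "z \<in> orbit x" "z \<in> orbit y" by blast
    then obtain s t where st: "s \<in> H" "t \<in> H" "s x = t y" by (fastforce simp: orbit_def)
    then have "(inv' t \<circ> s) x = y" using permutes_inverses[OF permutes[OF st(2)]] by simp
    then show False using xy(3) comp_in inv_in st by blast
  qed
  let ?c = "\<lambda>y. card {t \<in> H. t y = y}"
  have "2 * card H = sum ?c (orbit x) + sum ?c (orbit y)"
    using sum_stabilizers_orbit xy by simp
  also have "\<dots> = sum ?c (orbit x \<union> orbit y)"
    using disj by (intro sum.union_disjoint[symmetric]) (auto simp: orbit_def)
  also have "\<dots> \<le> sum ?c {1..d}" by (intro sum_mono2) (auto simp: orbit_def)
  finally show ?thesis using sum_nfix by simp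
qed

lemma nfix_le: "nfix d s \<le> d"
proof -
  have "nfix d s \<le> card {1..d}" by (intro card_mono) auto
  then show ?thesis by simp
qed

lemma nfix_eq_iff:
  assumes "s \<in> H"
  shows "nfix d s = d \<longleftrightarrow> s = id"
proof
  assume "nfix d s = d"
  then have "{x \<in> {1..d}. s x = x} = {1..d}" by (intro card_subset_eq) auto
  then have "s x = x" for x
    using permutes_not_in[OF permutes[OF assms], of x] by (cases "x \<in> {1..d}") blast+
  then show "s = id" by auto
next
  assume "s = id"
  then have "{x \<in> {1..d}. s x = x} = {1..d}" by auto
  then show "nfix d s = d" by simp
qed

section \<open>Probability generating function of the number of fixed points, and the recursion it
  drives\<close>

definition pgf :: "real \<Rightarrow> real" where
  "pgf q = (\<Sum>s\<in>H. q ^ nfix d s) / real (card H)"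

definition der_ratio :: "nat \<Rightarrow> real" where
  "der_ratio n = real (card (derangements d H n)) / real (card (wreath_level d H n))"

lemma card_wreath_level_Suc:
  "card (wreath_level d H (Suc n)) = card H * card (wreath_level d H n) ^ d"
proof -
  let ?P = "H \<times> (\<Pi>\<^sub>E x\<in>{1..d}. wreath_level d H n)"
  have "card (wreath_level d H (Suc n)) = card (level_glue d n ` ?P)"
    by (simp only: level_glue_image[OF permutes])
  also have "\<dots> = card ?P" by (rule card_image[OF level_glue_inj[OF permutes]])
  also have "\<dots> = card H * card (wreath_level d H n) ^ d"
    by (simp add: card_cartesian_product card_PiE)
  finally show ?thesis .
qed

lemma card_wreath_level:
  "finite (wreath_level d H n) \<and> card (wreath_level d H n) > 0"
proof (induction n)
  case 0
  have "id \<in> tree_aut d" by (simp add: tree_aut_def permutes_id)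
  moreover have "label d id v = id" for v by (auto simp: label_def aut_section_def fun_eq_iff)
  ultimately have "id \<in> iterated_wreath d H" using id_in by (simp add: iterated_wreath_def)
  \<comment> \<open>Only the root survives the restriction, and every automorphism fixes it.\<close>
  moreover have "level_restrict d 0 g = level_restrict d 0 id" if "g \<in> iterated_wreath d H" for g
    using that by (auto simp: level_restrict_def iterated_wreath_def tree_aut_def fun_eq_iff)
  ultimately have "wreath_level d H 0 = {level_restrict d 0 id}"
    unfolding wreath_level_def by blast
  then show ?case by simp
next
  case (Suc n)
  have "finite (level_glue d n ` (H \<times> (\<Pi>\<^sub>E x\<in>{1..d}. wreath_level d H n)))"
    using Suc finite_H by (intro finite_imageI finite_cartesian_product finite_PiE) auto
  then show ?case
    using Suc card_pos by (simp only: level_glue_image[OF permutes] card_wreath_level_Suc) simp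
qed

lemma der_ratio_0: "der_ratio 0 = 0"
proof -
  have "derangements d H 0 = {}"
    by (auto simp: derangements_def level_def dest: wreath_level_Nil)
  then show ?thesis by (simp add: der_ratio_def)
qed

lemma der_ratio_Suc: "der_ratio (Suc n) = pgf (der_ratio n)"
proof -
  let ?R = "wreath_level d H n" and ?D = "derangements d H n"
  let ?S = "SIGMA s:H. \<Pi>\<^sub>E x\<in>{1..d}. if s x = x then ?D else ?R"
  have fin: "finite ?R" "card ?R > 0" using card_wreath_level by auto
  have sub: "?D \<subseteq> ?R" by (auto simp: derangements_def)
  then have finD: "finite ?D" using fin finite_subset by blast
  have subS: "?S \<subseteq> H \<times> (\<Pi>\<^sub>E x\<in>{1..d}. ?R)"
    by (intro Sigma_mono PiE_mono order.refl) (use sub in auto)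
  have "inj_on (level_glue d n) ?S"
    using inj_on_subset[OF level_glue_inj subS] permutes by blast
  then have "card (derangements d H (Suc n)) = card ?S"
    by (simp only: derangements_Suc[OF permutes] card_image)
  also have "\<dots> = (\<Sum>s\<in>H. \<Prod>x\<in>{1..d}. card (if s x = x then ?D else ?R))"
    using fin finD finite_H by (subst card_SigmaI) (auto intro!: finite_PiE simp: card_PiE)
  finally have D: "card (derangements d H (Suc n)) =
    (\<Sum>s\<in>H. \<Prod>x\<in>{1..d}. card (if s x = x then ?D else ?R))" .
  \<comment> \<open>Distribute the denominator over the letters: a fixed letter gives
    \<open>der_ratio n\<close>, a moved one gives 1.\<close>
  have factor: "(\<Prod>x\<in>{1..d}. real (card (if s x = x then ?D else ?R))) / real (card ?R) ^ d
      = der_ratio n ^ nfix d s" for s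
  proof -
    have "(\<Prod>x\<in>{1..d}. real (card (if s x = x then ?D else ?R))) / real (card ?R) ^ d
      = (\<Prod>x\<in>{1..d}. real (card (if s x = x then ?D else ?R)) / real (card ?R))"
      by (simp add: prod_dividef)
    also have "\<dots> = (\<Prod>x\<in>{1..d}. if s x = x then der_ratio n else 1)"
      using fin by (intro prod.cong) (auto simp: der_ratio_def)
    also have "\<dots> = der_ratio n ^ nfix d s"
      by (simp add: prod.inter_filter[symmetric])
    finally show ?thesis .
  qed
  have "der_ratio (Suc n) = (\<Sum>s\<in>H. (\<Prod>x\<in>{1..d}. real (card (if s x = x then ?D else ?R)))
      / real (card ?R) ^ d) / real (card H)"
    unfolding der_ratio_def[of "Suc n"] D card_wreath_level_Suc
    by (simp add: sum_divide_distrib[symmetric])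
  then show ?thesis unfolding factor pgf_def .
qed

lemma fix_ratio_eq: "fix_ratio d (iterated_wreath d H) n = 1 - der_ratio n"
proof -
  let ?R = "wreath_level d H n"
  have fin: "finite ?R" "card ?R > 0" using card_wreath_level by auto
  have sub: "derangements d H n \<subseteq> ?R" by (auto simp: derangements_def)
  have "{g \<in> ?R. \<exists>v\<in>level d n. g v = v} = ?R - derangements d H n"
    by (auto simp: derangements_def)
  then have "real (card {g \<in> ?R. \<exists>v\<in>level d n. g v = v}) =
      real (card ?R) - real (card (derangements d H n))"
    using card_Diff_subset[OF finite_subset[OF sub fin(1)] sub] card_mono[OF fin(1) sub]
    by (simp add: of_nat_diff)
  then show ?thesis
    using fin unfolding fix_ratio_def wreath_level_def[symmetric] der_ratio_def
    by (simp add: diff_divide_distrib card_gt_0_iff)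
qed

lemma pgf_mono: "0 \<le> p \<Longrightarrow> p \<le> q \<Longrightarrow> pgf p \<le> pgf q"
  unfolding pgf_def by (intro divide_right_mono sum_mono power_mono) auto

lemma pgf_1: "pgf 1 = 1"
  using card_pos by (simp add: pgf_def)

lemma der_ratio_nonneg: "0 \<le> der_ratio n"
  by (simp add: der_ratio_def)

text \<open>Iterating the monotone \<open>pgf\<close> from 0 never passes such a \<open>c\<close>.
  With \<open>c = 1\<close> this bounds the sequence; for general \<open>c\<close> it makes the
  limit the least nonnegative one.\<close>

lemma der_ratio_le_prefixed:
  assumes "0 \<le> c" "pgf c \<le> c"
  shows "der_ratio n \<le> c"
proof (induction n)
  case (Suc n)
  then show ?case using pgf_mono[OF der_ratio_nonneg Suc] assms by (simp add: der_ratio_Suc)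
qed (simp add: der_ratio_0 assms)

lemma der_ratio_incseq: "incseq der_ratio"
proof (rule incseq_SucI)
  show "der_ratio n \<le> der_ratio (Suc n)" for n
  proof (induction n)
    case (Suc n)
    then show ?case using pgf_mono[OF der_ratio_nonneg Suc] by (simp add: der_ratio_Suc)
  qed (simp add: der_ratio_0 der_ratio_nonneg)
qed

lemma der_ratio_limit:
  obtains q where "der_ratio \<longlonglongrightarrow> q" "pgf q = q" "0 \<le> q" "\<And>n. der_ratio n \<le> q"
    "\<And>c. 0 \<le> c \<Longrightarrow> pgf c \<le> c \<Longrightarrow> q \<le> c"
proof -
  have "\<forall>n. der_ratio n \<le> 1" using der_ratio_le_prefixed[of 1] pgf_1 by simp
  then obtain q where q: "der_ratio \<longlonglongrightarrow> q" "\<And>n. der_ratio n \<le> q"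
    using incseq_convergent[OF der_ratio_incseq] by metis
  have "(\<lambda>n. pgf (der_ratio n)) \<longlonglongrightarrow> pgf q"
    unfolding pgf_def using card_pos by (intro tendsto_intros q) auto
  moreover have "(\<lambda>n. pgf (der_ratio n)) \<longlonglongrightarrow> q"
    using LIMSEQ_Suc[OF q(1)] by (simp add: der_ratio_Suc)
  ultimately have "pgf q = q" by (rule LIMSEQ_unique)
  moreover have "q \<le> c" if "0 \<le> c" "pgf c \<le> c" for c
    using LIMSEQ_le_const2[OF q(1)] der_ratio_le_prefixed[OF that] by blast
  moreover have "0 \<le> q" using q(2)[of 0] by (simp add: der_ratio_0)
  ultimately show ?thesis using that q by blast
qed

end

section \<open>Power estimates and shifts of algebraic integers\<close>

lemma Bernoulli_inequality_strict:
  fixes q :: real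
  assumes "0 \<le> q" "q < 1" "k \<ge> 2"
  shows "1 + real k * (q - 1) < q ^ k"
proof -
  obtain j where k: "k = Suc j" "j > 0" using assms(3) by (cases k) auto
  \<comment> \<open>This is exactly the gap between the two sides of the next inequality; it is
    positive because \<open>k\<close> is at least 2.\<close>
  have "0 < real j * (q - 1)\<^sup>2" using k assms by simp
  then have "1 + real k * (q - 1) < q * (1 + real j * (q - 1))"
    by (simp add: k algebra_simps power2_eq_square)
  also have "\<dots> \<le> q * q ^ j"
    using Bernoulli_inequality[of "q - 1" j] assms by (intro mult_left_mono) auto
  finally show ?thesis by (simp add: k)
qed

text \<open>Second-order bound near 1. The generous coefficient \<open>k^2\<close> suits the
  induction, which only needs \<open>k^2 + k \<le> (k + 1)^2\<close>.\<close>

lemma one_minus_power_le: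
  fixes p :: real
  assumes "0 \<le> p" "p \<le> 1"
  shows "(1 - p) ^ k \<le> 1 - real k * p + (real k)\<^sup>2 * p\<^sup>2"
proof (induction k)
  case (Suc k)
  have "(1 - p) ^ Suc k \<le> (1 - p) * (1 - real k * p + (real k)\<^sup>2 * p\<^sup>2)"
    using Suc assms by (simp add: mult_left_mono)
  also have "\<dots> = 1 - real (Suc k) * p + ((real k)\<^sup>2 + real k) * p\<^sup>2 - (real k)\<^sup>2 * p ^ 3"
    by (simp add: algebra_simps power2_eq_square power3_eq_cube)
  also have "\<dots> \<le> 1 - real (Suc k) * p + ((real k)\<^sup>2 + real k) * p\<^sup>2"
    using assms by simp
  also have "((real k)\<^sup>2 + real k) * p\<^sup>2 \<le> (real (Suc k))\<^sup>2 * p\<^sup>2"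
    by (intro mult_right_mono) (simp_all add: power2_eq_square algebra_simps)
  finally show ?case by simp
qed simp

lemma Ints_coeff_pcompose:
  assumes "\<forall>i. coeff p i \<in> \<int>" "\<forall>i. coeff q i \<in> \<int>"
  shows "coeff (pcompose p q) i \<in> \<int>"
  using assms(1)
proof (induction p arbitrary: i)
  case (pCons a p)
  have "a \<in> \<int>" "\<forall>i. coeff p i \<in> \<int>"
    using pCons.prems by (metis coeff_pCons_0, metis coeff_pCons_Suc)
  then show ?case
    using pCons.IH assms(2)
    by (auto simp: pcompose_pCons coeff_mult coeff_pCons split: nat.splits
        intro!: Ints_add Ints_sum Ints_mult)
qed simp

text \<open>Substituting \<open>X + 1\<close> into a monic integer polynomial keeps it monic and
  integral and shifts its roots by 1. This takes the limit \<open>q\<close> to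
  \<open>1 - q\<close>.\<close>

lemma algebraic_int_diff_1:
  assumes "algebraic_int (x :: real)"
  shows "algebraic_int (x - 1)"
proof -
  obtain p where p: "lead_coeff p = 1" "\<forall>i. coeff p i \<in> \<int>" "poly p x = 0"
    using assms by (auto elim: algebraic_int.cases)
  show ?thesis
  proof (rule algebraic_int.intros)
    show "lead_coeff (pcompose p [:1, 1:]) = 1" using p by (simp add: lead_coeff_comp)
    have "\<forall>i. coeff [:1, 1 :: real:] i \<in> \<int>" by (auto simp: coeff_pCons split: nat.splits)
    then show "\<forall>i. coeff (pcompose p [:1, 1:]) i \<in> \<int>" using p(2) Ints_coeff_pcompose by blast
    show "poly (pcompose p [:1, 1:]) (x - 1) = 0" using p by (simp add: poly_pcompose)
  qed
qed

section \<open>Fixed points of the generating function in the critical and supercritical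
  cases\<close>

context perm_group
begin

lemma algebraic_int_pgf_fixpoint:
  assumes "pgf q = q"
  shows "algebraic_int q"
proof (rule algebraic_int.intros)
  let ?P = "(\<Sum>s\<in>H. monom 1 (nfix d s)) - monom (real (card H)) 1"
  have coeff: "coeff ?P i = real (card {s \<in> H. nfix d s = i}) - (if i = 1 then real (card H) else 0)"
    for i
    using finite_H by (simp add: coeff_sum sum.inter_filter[symmetric])
  have "{s \<in> H. nfix d s = d} = {id}" using nfix_eq_iff id_in by auto
  \<comment> \<open>Since \<open>d\<close> is at least 2, the subtracted linear term does not reach
    degree \<open>d\<close>.\<close>
  then have lead: "coeff ?P d = 1" using d2 unfolding coeff by simp
  have "coeff ?P i = 0" if "i > d" for i
  proof -
    have "{s \<in> H. nfix d s = i} = {}" using that nfix_le by (auto simp: not_le[symmetric])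
    then show ?thesis using that d2 unfolding coeff \<open>_ = {}\<close> by simp
  qed
  then have "degree ?P \<le> d" by (intro degree_le) auto
  moreover have "d \<le> degree ?P" using lead by (intro le_degree) simp
  ultimately show "lead_coeff ?P = 1" using lead by simp
  show "\<forall>i. coeff ?P i \<in> \<int>" unfolding coeff by auto
  show "poly ?P q = 0"
    using assms card_pos by (simp add: pgf_def poly_sum poly_monom field_simps)
qed

text \<open>Each power lies above its tangent at 1. By transitivity the tangents average to the
  diagonal, and the identity, with its \<open>d \<ge> 2\<close> fixed points, makes the inequality
  strict.\<close>

lemma pgf_greater:
  assumes "transitive_over H {1..d}" "0 \<le> q" "q < 1"
  shows "q < pgf q"
proof -
  have "real (card H) * q = real (card H) + real (\<Sum>s\<in>H. nfix d s) * (q - 1)"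
    using sum_nfix_transitive[OF assms(1)] by (simp add: algebra_simps)
  also have "\<dots> = (\<Sum>s\<in>H. 1 + real (nfix d s) * (q - 1))"
    by (simp add: sum.distrib sum_distrib_right)
  also have "\<dots> < (\<Sum>s\<in>H. q ^ nfix d s)"
  proof (rule sum_strict_mono_ex1[OF finite_H])
    show "\<forall>s\<in>H. 1 + real (nfix d s) * (q - 1) \<le> q ^ nfix d s"
      using Bernoulli_inequality[of "q - 1"] assms by auto
    show "\<exists>s\<in>H. 1 + real (nfix d s) * (q - 1) < q ^ nfix d s"
      using Bernoulli_inequality_strict[of q d] assms d2 id_in nfix_eq_iff[OF id_in]
      by (intro bexI[of _ id]) simp_all
  qed
  finally show ?thesis using card_pos by (simp add: pgf_def field_simps)
qed

lemma pgf_less_one_fixpoint: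
  assumes "\<not> transitive_over H {1..d}"
  shows "\<exists>c. 0 \<le> c \<and> c < 1 \<and> pgf c \<le> c"
proof (intro exI conjI)
  \<comment> \<open>Chosen so that the quadratic error \<open>d^2 * p^2\<close> equals
    \<open>p\<close>. The linear term gains at least \<open>2 * p\<close> on average, so the mean is
    at most \<open>1 - 2 * p + p = 1 - p\<close>.\<close>
  define p where "p = 1 / (real d)\<^sup>2"
  have "1 \<le> (real d)\<^sup>2" using d2 by (intro one_le_power) simp
  then have p: "0 < p" "p \<le> 1" "(real d)\<^sup>2 * p\<^sup>2 = p"
    using d2 by (auto simp: p_def power2_eq_square field_simps)
  show "0 \<le> 1 - p" "1 - p < 1" using p by auto
  have "(\<Sum>s\<in>H. (1 - p) ^ nfix d s) \<le> (\<Sum>s\<in>H. 1 - real (nfix d s) * p + p)"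
  proof (rule sum_mono)
    fix s
    have "(real (nfix d s))\<^sup>2 * p\<^sup>2 \<le> (real d)\<^sup>2 * p\<^sup>2"
      using nfix_le by (intro mult_right_mono power_mono) auto
    then show "(1 - p) ^ nfix d s \<le> 1 - real (nfix d s) * p + p"
      using one_minus_power_le[of p "nfix d s"] p by linarith
  qed
  also have "\<dots> = real (card H) * (1 + p) - real (\<Sum>s\<in>H. nfix d s) * p"
    by (simp add: sum.distrib sum_subtractf sum_distrib_left algebra_simps)
  also have "\<dots> \<le> real (card H) * (1 + p) - real (2 * card H) * p"
    using sum_nfix_intransitive[OF assms] p
    by (intro diff_left_mono mult_right_mono) (auto simp only: of_nat_le_iff less_imp_le)
  also have "\<dots> = real (card H) * (1 - p)" by (simp add: algebra_simps)
  finally show "pgf (1 - p) \<le> 1 - p" using card_pos by (simp add: pgf_def field_simps)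
qed

text \<open>As \<open>0 ^ 0 = 1\<close>, exactly the elements without fixed points
  contribute.\<close>

lemma pgf_0: "pgf 0 = real (card {s \<in> H. nfix d s = 0}) / real (card H)"
  using finite_H by (simp add: pgf_def power_0_left sum.inter_filter[symmetric])

end

theorem corollary4:
  fixes d :: nat and H :: "(nat \<Rightarrow> nat) set"
  assumes "d \<ge> 2" and "subgroup H (sym_group d)"
  shows "convergent (fix_ratio d (iterated_wreath d H)) \<and>
    (transitive_over H {1..d} \<longrightarrow> FPP d (iterated_wreath d H) = 0) \<and>
    (\<not> transitive_over H {1..d} \<and> (\<exists>\<sigma>\<in>H. \<forall>x\<in>{1..d}. \<sigma> x \<noteq> x) \<longrightarrow>
       FPP d (iterated_wreath d H) \<in> {0<..<1} \<and> algebraic_int (FPP d (iterated_wreath d H))) \<and>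
    (\<not> transitive_over H {1..d} \<and> (\<forall>\<sigma>\<in>H. \<exists>x\<in>{1..d}. \<sigma> x = x) \<longrightarrow>
       FPP d (iterated_wreath d H) = 1)"
proof -
  interpret perm_group d H using assms by (rule perm_group.intro)
  obtain q where q: "der_ratio \<longlonglongrightarrow> q" "pgf q = q" "0 \<le> q" "\<And>n. der_ratio n \<le> q"
    "\<And>c. 0 \<le> c \<Longrightarrow> pgf c \<le> c \<Longrightarrow> q \<le> c"
    using der_ratio_limit by blast
  have "fix_ratio d (iterated_wreath d H) \<longlonglongrightarrow> 1 - q"
    unfolding fix_ratio_eq[abs_def] by (intro tendsto_intros q)
  then have conv: "convergent (fix_ratio d (iterated_wreath d H))"
    and FPP: "FPP d (iterated_wreath d H) = 1 - q"
    by (auto simp: convergent_def FPP_def limI)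
  have "q \<le> 1" using q(5)[of 1] pgf_1 by simp
  then have "q = 1" if "transitive_over H {1..d}"
    using pgf_greater[OF that q(3)] q(2) by fastforce
  \<comment> \<open>Already \<open>der_ratio 1 = pgf 0\<close> is positive, and it bounds
    \<open>q\<close> from below.\<close>
  moreover have "0 < q" if s: "s \<in> H" "\<forall>x\<in>{1..d}. s x \<noteq> x" for s
  proof -
    have "nfix d s = 0" using s by auto
    then have "{s \<in> H. nfix d s = 0} \<noteq> {}" using s by blast
    then have "0 < pgf 0" using finite_H card_pos by (simp add: pgf_0 card_gt_0_iff)
    also have "\<dots> \<le> q" using q(4)[of 1] by (simp add: der_ratio_Suc der_ratio_0)
    finally show ?thesis .
  qed
  moreover have "q < 1" if "\<not> transitive_over H {1..d}"
    using pgf_less_one_fixpoint[OF that] q(5) by force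
  moreover have "algebraic_int (1 - q)"
    using algebraic_int_minus[OF algebraic_int_diff_1[OF algebraic_int_pgf_fixpoint[OF q(2)]]]
    by simp
  moreover have "q = 0" if fixing: "\<forall>s\<in>H. \<exists>x\<in>{1..d}. s x = x"
  proof -
    have "nfix d s \<noteq> 0" if "s \<in> H" for s
    proof -
      have "{x \<in> {1..d}. s x = x} \<noteq> {}" using fixing that by blast
      then show ?thesis by (subst card_0_eq) simp_all
    qed
    then have "{s \<in> H. nfix d s = 0} = {}" by blast
    \<comment> \<open>So 0 is itself a fixed point, and minimality of \<open>q\<close> forces
      \<open>q = 0\<close>.\<close>
    then have "pgf 0 = 0" unfolding pgf_0 by (simp only: card.empty)
    then show ?thesis using q(3) q(5)[of 0] by simp
  qed
  ultimately show ?thesis unfolding FPP using conv by auto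
qed

end
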